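(* Let $M,N$ be weights of $\mathbb{R}^m,\mathbb{R}^n$, let $A\in\mathbb{R}^{m\times n}$ with $MA=AN$, and let $K\subseteq\mathbb{R}^n$ be a closed cone. Then $$A^{[\dagger]}\circ A\circ K\subseteq K\iff A^{[\dagger]}\circ A\circ K^{[*]}\subseteq K^{[*]}.$$
   Context: A weight is a real symmetric matrix $W$ with $W^2=I$. $\mathbb{R}^m$ and $\mathbb{R}^n$ carry weights $M\in\mathbb{R}^{m\times m}$ and $N\in\mathbb{R}^{n\times n}$, respectively. The indefinite inner product on the space with weight $W$ is $[x,y]=\langle x,Wy\rangle$. Indefinite matrix product: if $B$ has $p$ columns and $C$ has $p$ rows (or is a vector in $\mathbb{R}^p$), $p\in\{m,n\}$, and $W$ is the weight of $\mathbb{R}^p$, then $B\circ C:=BWC$. $I$ denotes an identity matrix of the appropriate size. Indefinite adjoint of $B\in\mathbb{R}^{p\times q}$: $B^{[*]}:=W_qB^TW_p$, where $W_p,W_q$ are the weights of $\mathbb{R}^p,\mathbb{R}^q$. Indefinite Moore–Penrose inverse: for $A\in\mathbb{R}^{m\times n}$, $A^{[\dagger]}$ is the unique $X\in\mathbb{R}^{n\times m}$ such that - $A\circ X\circ A=A$, - $X\circ A\circ X=X$, - $(A\circ X)^{[*]}=A\circ X$, - $(X\circ A)^{[*]}=X\circ A$. It exists and equals $NA^{\dagger}M$, where $A^\dagger$ is the usual Moore–Penrose inverse. A cone is a nonempty set closed under addition and under multiplication by nonnegative scalars. For $S$ a subset of $\mathbb{R}^p$ with weight $W$, the dual is $S^{[*]}=\{x\in\mathbb{R}^p:[x,t]\ge0\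 \forall t\in S\}$. For a matrix $B$ and a set $S$, $B\circ S=\{B\circ s:s\in S\}$. *)

theory Defs
  imports "HOL-Analysis.Analysis"
begin

text \<open>A weight: real symmetric matrix W with W^2 = I.\<close>
definition weight :: "real^'n^'n \<Rightarrow> bool" where
  "weight W \<longleftrightarrow> transpose W = W \<and> W ** W = mat 1"

text \<open>Indefinite adjoint of B (p x q), Wp weight of R^p, Wq weight of R^q: Wq B^T Wp.\<close>
definition indef_adj :: "real^'p^'p \<Rightarrow> real^'q^'q \<Rightarrow> real^'q^'p \<Rightarrow> real^'p^'q" where
  "indef_adj Wp Wq B = Wq ** transpose B ** Wp"

text \<open>Indefinite Moore-Penrose inverse of A (m x n), M weight of R^m, N weight of R^n.
  Indefinite products: A o X = A N X, X o A = X M A.\<close>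
definition indef_mp :: "real^'m^'m \<Rightarrow> real^'n^'n \<Rightarrow> real^'n^'m \<Rightarrow> real^'m^'n" where
  "indef_mp M N A = (THE X.
      A ** N ** X ** M ** A = A \<and>
      X ** M ** A ** N ** X = X \<and>
      indef_adj M M (A ** N ** X) = A ** N ** X \<and>
      indef_adj N N (X ** M ** A) = X ** M ** A)"

text \<open>Indefinite dual of a set S in a space with weight W.\<close>
definition indef_dual :: "real^'n^'n \<Rightarrow> (real^'n) set \<Rightarrow> (real^'n) set" where
  "indef_dual W S = {x. \<forall>t\<in>S. inner x (W *v t) \<ge> 0}"

definition is_cone :: "(real^'n) set \<Rightarrow> bool" where
  "is_cone K \<longleftrightarrow> K \<noteq> {} \<and> (\<forall>x\<in>K. \<forall>y\<in>K. x + y \<in> K) \<and> (\<forall>c::real. c \<ge> 0 \<longrightarrow> (\<forall>x\<in>K. c *\<^sub>R x \<in> K))"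

end

theory Submission
  imports Defs
begin

text \<open>Because \<open>M A = A N\<close>, the indefinite Moore-Penrose inverse \<open>N A\<^sup>\<dagger> M\<close> equals the
  ordinary one \<open>A\<^sup>\<dagger>\<close>, so the map in question is the orthogonal projection \<open>P = A\<^sup>\<dagger> A\<close>,
  which is symmetric and commutes with \<open>N\<close>. The \<open>N\<close>-dual of \<open>K\<close> is the image under \<open>N\<close> of the
  Euclidean dual cone \<open>K\<^sup>*\<close>, so \<open>P\<close> preserves it iff \<open>P\<close> preserves \<open>K\<^sup>*\<close>. A symmetric map
  preserving \<open>K\<close> preserves \<open>K\<^sup>*\<close>; the converse is the same fact applied to \<open>K\<^sup>*\<close>, together
  with the bipolar theorem \<open>K\<^sup>*\<^sup>* = K\<close> for closed convex cones.\<close>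

definition moore_penrose :: "real^'n^'m \<Rightarrow> real^'m^'n \<Rightarrow> bool" where
  "moore_penrose A X \<longleftrightarrow> A ** X ** A = A \<and> X ** A ** X = X \<and>
     transpose (A ** X) = A ** X \<and> transpose (X ** A) = X ** A"

lemma moore_penrose_transpose:
  assumes "moore_penrose A X"
  shows "moore_penrose (transpose A) (transpose X)"
proof -
  have "transpose A ** transpose X ** transpose A = transpose (A ** X ** A)"
    and "transpose X ** transpose A ** transpose X = transpose (X ** A ** X)"
    and "transpose A ** transpose X = transpose (X ** A)"
    and "transpose X ** transpose A = transpose (A ** X)"
    by (simp_all add: matrix_transpose_mul matrix_mul_assoc)
  with assms show ?thesis
    by (simp add: moore_penrose_def)
qed

lemma moore_penrose_left_product_eq:
  assumes X: "moore_penrose A X" and Y: "moore_penrose A Y"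
  shows "A ** X = A ** Y"
proof -
  have "A ** X = (A ** Y) ** (A ** X)"
    using Y by (simp add: moore_penrose_def matrix_mul_assoc)
  also have "\<dots> = transpose (A ** Y) ** transpose (A ** X)"
    using X Y by (simp add: moore_penrose_def)
  also have "\<dots> = transpose (A ** X ** A ** Y)"
    by (simp add: matrix_transpose_mul matrix_mul_assoc)
  also have "\<dots> = A ** Y"
    using X Y by (simp add: moore_penrose_def)
  finally show ?thesis .
qed

lemma moore_penrose_unique:
  assumes X: "moore_penrose A X" and Y: "moore_penrose A Y"
  shows "X = Y"
proof -
  have AX: "A ** X = A ** Y"
    using X Y by (rule moore_penrose_left_product_eq)
  have "transpose A ** transpose X = transpose A ** transpose Y"
    using X Y by (intro moore_penrose_left_product_eq moore_penrose_transpose)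
  then have XA: "X ** A = Y ** A"
    by (metis matrix_transpose_mul transpose_transpose)
  have "X = X ** (A ** X)"
    using X by (simp add: moore_penrose_def matrix_mul_assoc)
  also have "\<dots> = X ** A ** Y"
    by (simp add: AX matrix_mul_assoc)
  also have "\<dots> = Y ** A ** Y"
    by (simp add: XA)
  also have "\<dots> = Y"
    using Y by (simp add: moore_penrose_def)
  finally show ?thesis .
qed

lemma inner_symmetric_matrix:
  fixes P :: "real^'n^'n"
  assumes "transpose P = P"
  shows "inner (P *v x) y = inner x (P *v y)"
  by (metis assms dot_lmul_matrix transpose_matrix_vector)

lemma linear_if_self_adjoint:
  fixes f :: "'a::real_inner \<Rightarrow> 'a"
  assumes adj: "\<And>x y. inner (f x) y = inner x (f y)"
  shows "linear f"
proof
  show "f (x + y) = f x + f y" for x y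
    by (rule vector_eq_rdot[THEN iffD1]) (simp add: adj inner_add_left inner_add_right)
  show "f (c *\<^sub>R x) = c *\<^sub>R f x" for c x
    by (rule vector_eq_rdot[THEN iffD1]) (simp add: adj)
qed

lemma symmetric_if_self_adjoint:
  fixes B :: "real^'n^'n"
  assumes "\<And>x y. inner (B *v x) y = inner x (B *v y)"
  shows "transpose B = B"
  unfolding matrix_eq
proof
  show "transpose B *v x = B *v x" for x
    by (rule vector_eq_rdot[THEN iffD1]) (simp add: dot_lmul_matrix assms)
qed

lemma orthogonal_projection_matrix_exists:
  fixes S :: "(real^'n) set"
  assumes "subspace S"
  obtains P :: "real^'n^'n"
  where "transpose P = P" "\<And>x. P *v x \<in> S" "\<And>x. x \<in> S \<Longrightarrow> P *v x = x"
proof -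
  have span_S: "span S = S"
    using assms by simp
  have "\<exists>y. y \<in> S \<and> (\<forall>w\<in>S. inner (x - y) w = 0)" for x
  proof -
    obtain y z where "y \<in> span S" "\<And>w. w \<in> span S \<Longrightarrow> orthogonal z w" "x = y + z"
      using orthogonal_subspace_decomp_exists[of S x] by blast
    then show ?thesis
      by (auto simp: span_S orthogonal_def)
  qed
  then obtain p where p_in: "\<And>x. p x \<in> S"
    and p_orth: "\<And>x w. w \<in> S \<Longrightarrow> inner (x - p x) w = 0"
    by metis
  have adj: "inner (p x) y = inner x (p y)" for x y
  proof -
    have "inner (p x) y = inner (p x) (p y)"
      using p_orth[OF p_in, of y x] by (simp add: inner_diff_left) (simp add: inner_commute)
    also have "\<dots> = inner x (p y)"
      using p_orth[OF p_in, of x y] by (simp add: inner_diff_left)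
    finally show ?thesis .
  qed
  have fix_S: "p x = x" if "x \<in> S" for x
    using p_orth[of "x - p x" x] p_in[of x] that assms
    by (simp add: subspace_diff)
  define P where "P = matrix p"
  have Pp: "P *v x = p x" for x
    using linear_if_self_adjoint[OF adj]
    by (simp add: P_def matrix_works linear_matrix_vector_mul_eq)
  show ?thesis
  proof
    show "transpose P = P" by (rule symmetric_if_self_adjoint) (simp add: Pp adj)
  qed (simp_all add: Pp p_in fix_S)
qed

lemma matrix_mult_projection_row_space:
  fixes A :: "real^'n^'m" and P :: "real^'n^'n"
  assumes sym: "transpose P = P"
    and into: "\<And>x. P *v x \<in> range ((*v) (transpose A))"
    and on_range: "\<And>x. x \<in> range ((*v) (transpose A)) \<Longrightarrow> P *v x = x"
  shows "A ** P = A"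
proof -
  \<comment> \<open>the residual \<open>y - P y\<close> is orthogonal to the row space, which is the orthogonal
    complement of the kernel of \<open>A\<close>\<close>
  have "A *v (y - P *v y) = 0" for y
  proof (rule vector_eq_rdot[THEN iffD1], rule allI)
    fix z
    have "inner (A *v (y - P *v y)) z = inner (y - P *v y) (transpose A *v z)"
      by (metis dot_lmul_matrix inner_commute transpose_matrix_vector)
    also have "\<dots> = inner (y - P *v y) (P *v (transpose A *v z))"
      using on_range by simp
    also have "\<dots> = inner (P *v y - P *v (P *v y)) (transpose A *v z)"
      using inner_symmetric_matrix[OF sym, of "y - P *v y"]
      by (simp add: matrix_vector_mult_diff_distrib)
    also have "\<dots> = inner 0 z"
      using on_range into by simp
    finally show "inner (A *v (y - P *v y)) z = inner 0 z" .
  qed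
  then show ?thesis
    by (simp add: matrix_eq matrix_vector_mult_diff_distrib flip: matrix_vector_mul_assoc)
qed

lemma inj_on_row_space:
  fixes A :: "real^'n^'m"
  shows "inj_on ((*v) A) (range ((*v) (transpose A)))"
proof (rule linear_inj_on_iff_eq_0[THEN iffD2])
  show "\<forall>x\<in>range ((*v) (transpose A)). A *v x = 0 \<longrightarrow> x = 0"
  proof (intro ballI impI)
    fix x assume "x \<in> range ((*v) (transpose A))" "A *v x = 0"
    then obtain z where z: "x = transpose A *v z" by auto
    have "inner x x = inner z (A *v x)"
      by (simp add: z dot_lmul_matrix)
    with \<open>A *v x = 0\<close> show "x = 0" by simp
  qed
  show "subspace (range ((*v) (transpose A)))"
    by (intro linear_subspace_image subspace_UNIV matrix_vector_mul_linear)
qed simp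

lemma moore_penrose_exists:
  fixes A :: "real^'n^'m"
  obtains X where "moore_penrose A X"
proof -
  define R where "R = range ((*v) (transpose A))"
  define C where "C = range ((*v) A)"
  have "subspace R" "subspace C"
    unfolding R_def C_def by (intro linear_subspace_image subspace_UNIV matrix_vector_mul_linear)+
  obtain P where P: "transpose P = P" "\<And>x. P *v x \<in> R" "\<And>x. x \<in> R \<Longrightarrow> P *v x = x"
    using orthogonal_projection_matrix_exists[OF \<open>subspace R\<close>] by blast
  obtain Q where Q: "transpose Q = Q" "\<And>x. Q *v x \<in> C" "\<And>x. x \<in> C \<Longrightarrow> Q *v x = x"
    using orthogonal_projection_matrix_exists[OF \<open>subspace C\<close>] by blast
  have AP: "A *v (P *v x) = A *v x" for x
    using matrix_mult_projection_row_space[of P A] P unfolding R_def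
    by (simp add: matrix_vector_mul_assoc)
  obtain g where g_in: "range g \<subseteq> R" and "linear g"
    and g_inv: "\<And>r. r \<in> R \<Longrightarrow> g (A *v r) = r"
    using linear_exists_left_inverse_on[of "(*v) A" R] \<open>subspace R\<close> inj_on_row_space[of A]
    unfolding R_def by auto
  \<comment> \<open>\<open>X\<close> sends \<open>z\<close> to the preimage of \<open>Q z\<close> in the row space, so that \<open>A X = Q\<close>
    and \<open>X A = P\<close> are the orthogonal projections onto the column and row spaces\<close>
  define X where "X = matrix (g \<circ> (*v) Q)"
  have X: "X *v y = g (Q *v y)" for y
    using \<open>linear g\<close> by (simp add: X_def linear_compose matrix_works linear_matrix_vector_mul_eq)
  have gA: "g (A *v x) = P *v x" for x
    using g_inv[OF P(2)] AP by metis
  have AX: "A ** X = Q"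
  proof -
    have "A *v (X *v y) = Q *v y" for y
    proof -
      obtain x where "Q *v y = A *v x" using Q(2) unfolding C_def by blast
      then show ?thesis by (simp add: X gA AP)
    qed
    then show ?thesis by (simp add: matrix_eq flip: matrix_vector_mul_assoc)
  qed
  have XA: "X ** A = P"
    using Q(3) by (simp add: matrix_eq X gA C_def flip: matrix_vector_mul_assoc)
  have "A ** X ** A = A"
    using Q(3) by (simp add: AX matrix_eq C_def flip: matrix_vector_mul_assoc)
  moreover have "X ** A ** X = X"
    using P(3) g_in by (simp add: XA matrix_eq X flip: matrix_vector_mul_assoc) blast
  ultimately have "moore_penrose A X"
    using P(1) Q(1) by (simp add: moore_penrose_def AX XA)
  then show ?thesis by (rule that)
qed

definition moore_penrose_inverse :: "real^'n^'m \<Rightarrow> real^'m^'n" where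
  "moore_penrose_inverse A = (THE X. moore_penrose A X)"

lemma moore_penrose_inverse_eqI:
  assumes "moore_penrose A X"
  shows "moore_penrose_inverse A = X"
  unfolding moore_penrose_inverse_def using assms moore_penrose_unique by blast

lemma moore_penrose_moore_penrose_inverse: "moore_penrose A (moore_penrose_inverse A)"
  by (metis moore_penrose_exists moore_penrose_inverse_eqI)

lemma weight_mult_self_left:
  assumes "weight N"
  shows "N ** N ** Z = Z"
  using assms by (simp add: weight_def)

lemma weight_mult_self_right:
  assumes "weight N"
  shows "Z ** N ** N = Z"
  using assms unfolding weight_def by (metis matrix_mul_assoc matrix_mul_rid)

lemma weight_mult_cancel_left:
  assumes "weight M"
  shows "M ** U = M ** V \<longleftrightarrow> U = V"
  using assms unfolding weight_def by (metis matrix_mul_assoc matrix_mul_lid)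

lemma weight_mult_cancel_right:
  assumes "weight M"
  shows "U ** M = V ** M \<longleftrightarrow> U = V"
  using assms unfolding weight_def by (metis matrix_mul_assoc matrix_mul_rid)

lemma weight_eq_mult_left_iff:
  assumes "weight M"
  shows "U = M ** V \<longleftrightarrow> M ** U = V"
  using assms unfolding weight_def by (metis matrix_mul_assoc matrix_mul_lid)

lemma weight_eq_mult_right_iff:
  assumes "weight M"
  shows "U = V ** M \<longleftrightarrow> U ** M = V"
  using assms unfolding weight_def by (metis matrix_mul_assoc matrix_mul_rid)

lemma indef_penrose_iff:
  fixes M :: "real^'m^'m" and N :: "real^'n^'n" and A :: "real^'n^'m" and X :: "real^'m^'n"
  assumes M: "weight M" and N: "weight N"
  shows "(A ** N ** X ** M ** A = A \<and> X ** M ** A ** N ** X = X \<and>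
          indef_adj M M (A ** N ** X) = A ** N ** X \<and> indef_adj N N (X ** M ** A) = X ** M ** A)
     \<longleftrightarrow> moore_penrose A (N ** X ** M)"
proof -
  have tM: "transpose M = M" and tN: "transpose N = N"
    using M N by (simp_all add: weight_def)
  have "(N ** X ** M) ** A ** (N ** X ** M) = N ** X ** M \<longleftrightarrow>
        N ** (X ** M ** A ** N ** X) ** M = N ** X ** M"
    by (simp add: matrix_mul_assoc)
  also have "\<dots> \<longleftrightarrow> X ** M ** A ** N ** X = X"
    using weight_mult_cancel_left[OF N] weight_mult_cancel_right[OF M] by metis
  finally have c2: "(N ** X ** M) ** A ** (N ** X ** M) = N ** X ** M \<longleftrightarrow>
      X ** M ** A ** N ** X = X" .
  have "transpose (A ** (N ** X ** M)) = A ** (N ** X ** M) \<longleftrightarrow>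
        M ** transpose (A ** N ** X) = A ** N ** X ** M"
    using tM by (simp add: matrix_transpose_mul matrix_mul_assoc)
  also have "\<dots> \<longleftrightarrow> indef_adj M M (A ** N ** X) = A ** N ** X"
    unfolding indef_adj_def weight_eq_mult_right_iff[OF M]
    by (simp add: matrix_transpose_mul matrix_mul_assoc)
  finally have c3: "transpose (A ** (N ** X ** M)) = A ** (N ** X ** M) \<longleftrightarrow>
      indef_adj M M (A ** N ** X) = A ** N ** X" .
  have "transpose ((N ** X ** M) ** A) = (N ** X ** M) ** A \<longleftrightarrow>
        transpose (X ** M ** A) ** N = N ** (X ** M ** A)"
    using tN by (simp add: matrix_transpose_mul matrix_mul_assoc)
  also have "\<dots> \<longleftrightarrow> indef_adj N N (X ** M ** A) = X ** M ** A"
    unfolding indef_adj_def weight_eq_mult_left_iff[OF N] by (simp add: matrix_mul_assoc)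
  finally have c4: "transpose ((N ** X ** M) ** A) = (N ** X ** M) ** A \<longleftrightarrow>
      indef_adj N N (X ** M ** A) = X ** M ** A" .
  show ?thesis
    unfolding moore_penrose_def c2 c3 c4 by (simp add: matrix_mul_assoc)
qed

lemma indef_mp_eq_moore_penrose_inverse:
  assumes M: "weight M" and N: "weight N"
  shows "indef_mp M N A = N ** moore_penrose_inverse A ** M"
  unfolding indef_mp_def indef_penrose_iff[OF M N]
proof (rule the_equality)
  show "moore_penrose A (N ** (N ** moore_penrose_inverse A ** M) ** M)"
    using moore_penrose_moore_penrose_inverse[of A]
    by (simp add: matrix_mul_assoc weight_mult_self_left[OF N] weight_mult_self_right[OF M])
  show "Y = N ** moore_penrose_inverse A ** M" if "moore_penrose A (N ** Y ** M)" for Y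
    using moore_penrose_inverse_eqI[OF that]
    by (simp add: matrix_mul_assoc weight_mult_self_left[OF N] weight_mult_self_right[OF M])
qed

lemma moore_penrose_inverse_weight_conj:
  fixes M :: "real^'m^'m" and N :: "real^'n^'n" and A :: "real^'n^'m"
  assumes M: "weight M" and N: "weight N" and com: "M ** A = A ** N"
  shows "N ** moore_penrose_inverse A ** M = moore_penrose_inverse A"
proof (rule moore_penrose_inverse_eqI[symmetric])
  define X where "X = moore_penrose_inverse A"
  have X: "A ** X ** A = A" "X ** A ** X = X"
    "transpose (A ** X) = A ** X" "transpose (X ** A) = X ** A"
    using moore_penrose_moore_penrose_inverse[of A] by (simp_all add: X_def moore_penrose_def)
  have tM: "transpose M = M" and tN: "transpose N = N"
    using M N by (simp_all add: weight_def)
  have MAN: "M ** A ** N = A"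
    using com weight_mult_self_right[OF N] by metis
  have "A ** (N ** X ** M) ** A = M ** (A ** X ** A) ** N"
    by (metis com matrix_mul_assoc)
  moreover have "N ** X ** M ** A ** (N ** X ** M) = N ** (X ** (M ** A ** N) ** X) ** M"
    by (metis matrix_mul_assoc)
  moreover have "A ** (N ** X ** M) = M ** (A ** X) ** M"
    by (metis com matrix_mul_assoc)
  moreover have "N ** X ** M ** A = N ** (X ** A) ** N"
    by (metis com matrix_mul_assoc)
  ultimately show "moore_penrose A (N ** X ** M)"
    unfolding moore_penrose_def using X MAN tM tN
    by (simp add: matrix_transpose_mul matrix_mul_assoc)
qed

definition dual_cone :: "'a::real_inner set \<Rightarrow> 'a set" where
  "dual_cone K = {x. \<forall>t\<in>K. 0 \<le> inner x t}"

lemma self_adjoint_image_dual_cone: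
  assumes adj: "\<And>x y. inner (f x) y = inner x (f y)" and "f ` K \<subseteq> K"
  shows "f ` dual_cone K \<subseteq> dual_cone K"
  using assms by (force simp: dual_cone_def adj)

lemma dual_dual_cone:
  fixes K :: "'a::euclidean_space set"
  assumes "cone K" "convex K" "closed K" "0 \<in> K"
  shows "dual_cone (dual_cone K) = K"
proof
  show "K \<subseteq> dual_cone (dual_cone K)"
    by (auto simp: dual_cone_def inner_commute)
  show "dual_cone (dual_cone K) \<subseteq> K"
  proof
    fix z assume z: "z \<in> dual_cone (dual_cone K)"
    show "z \<in> K"
    proof (rule ccontr)
      assume "z \<notin> K"
      then obtain a b where ab: "inner a z < b" "\<forall>x\<in>K. b < inner a x"
        using separating_hyperplane_closed_point[OF assms(2,3)] by blast
      have "b < 0" using ab(2) \<open>0 \<in> K\<close> by force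
      have "a \<in> dual_cone K"
      proof (unfold dual_cone_def, intro CollectI ballI)
        fix x assume "x \<in> K"
        show "0 \<le> inner a x"
        proof (rule ccontr)
          assume neg: "\<not> 0 \<le> inner a x"
          then have "(b / inner a x) *\<^sub>R x \<in> K"
            using \<open>cone K\<close> \<open>x \<in> K\<close> \<open>b < 0\<close> by (simp add: mem_cone divide_nonpos_neg)
          with ab(2) neg show False by force
        qed
      qed
      with z ab(1) \<open>b < 0\<close> show False by (force simp: dual_cone_def inner_commute)
    qed
  qed
qed

lemma self_adjoint_preserves_cone_iff_dual_cone:
  fixes K :: "'a::euclidean_space set"
  assumes adj: "\<And>x y. inner (f x) y = inner x (f y)"
    and "cone K" "convex K" "closed K" "0 \<in> K"
  shows "f ` K \<subseteq> K \<longleftrightarrow> f ` dual_cone K \<subseteq> dual_cone K"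
  using self_adjoint_image_dual_cone[OF adj, of K]
    self_adjoint_image_dual_cone[OF adj, of "dual_cone K"] dual_dual_cone[OF assms(2-5)]
  by auto

lemma indef_dual_eq_image_dual_cone:
  assumes N: "weight N"
  shows "indef_dual N K = (*v) N ` dual_cone K"
proof -
  have NN: "N *v (N *v x) = x" for x
    using N by (simp add: matrix_vector_mul_assoc weight_def)
  have "x \<in> indef_dual N K \<longleftrightarrow> N *v x \<in> dual_cone K" for x
    using N by (simp add: indef_dual_def dual_cone_def inner_symmetric_matrix weight_def)
  then show ?thesis
    using NN by (auto simp: image_iff) (metis NN)
qed

lemma symmetric_preserves_cone_iff_indef_dual:
  fixes P N :: "real^'n^'n"
  assumes N: "weight N" and P: "transpose P = P" and NP: "N ** P = P ** N"
    and "cone K" "convex K" "closed K" "0 \<in> K"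
  shows "(*v) P ` K \<subseteq> K \<longleftrightarrow> (*v) P ` indef_dual N K \<subseteq> indef_dual N K"
proof -
  have "inj ((*v) N)"
    using N by (metis inj_on_inverseI matrix_vector_mul_assoc matrix_vector_mul_lid weight_def)
  have "(*v) P ` (*v) N ` D = (*v) N ` (*v) P ` D" for D
    by (auto simp: image_image matrix_vector_mul_assoc NP)
  then have "(*v) P ` indef_dual N K \<subseteq> indef_dual N K \<longleftrightarrow> (*v) P ` dual_cone K \<subseteq> dual_cone K"
    using \<open>inj ((*v) N)\<close> by (simp add: indef_dual_eq_image_dual_cone[OF N] inj_image_subset_iff)
  also have "\<dots> \<longleftrightarrow> (*v) P ` K \<subseteq> K"
    using self_adjoint_preserves_cone_iff_dual_cone[OF inner_symmetric_matrix[OF P]] assms(4-7)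
    by blast
  finally show ?thesis ..
qed

lemma is_cone_convex_cone:
  assumes "is_cone K"
  shows "cone K" and "convex K" and "0 \<in> K"
proof -
  show "cone K" "convex K"
    using assms unfolding is_cone_def cone_def convex_def by blast+
  then show "0 \<in> K"
    using assms cone_contains_0 by (auto simp: is_cone_def)
qed

theorem lemma3p3:
  fixes M :: "real^'m^'m" and N :: "real^'n^'n" and A :: "real^'n^'m"
    and K :: "(real^'n) set"
  assumes "weight M" and "weight N" and "M ** A = A ** N"
    and "is_cone K" and "closed K"
  shows "(\<lambda>k. indef_mp M N A ** M ** A ** N *v k) ` K \<subseteq> K \<longleftrightarrow>
         (\<lambda>k. indef_mp M N A ** M ** A ** N *v k) ` indef_dual N K \<subseteq> indef_dual N K"
proof -
  define X where "X = moore_penrose_inverse A"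
  have conj: "N ** X ** M = X"
    unfolding X_def using moore_penrose_inverse_weight_conj[OF assms(1-3)] .
  have "indef_mp M N A ** M ** A ** N = X ** A"
    using indef_mp_eq_moore_penrose_inverse[OF assms(1,2), of A] conj assms(3)
      weight_mult_self_right[OF assms(2)]
    by (metis X_def matrix_mul_assoc)
  moreover have "transpose (X ** A) = X ** A"
    using moore_penrose_moore_penrose_inverse[of A] by (simp add: X_def moore_penrose_def)
  moreover have "N ** (X ** A) = X ** A ** N"
    using conj weight_mult_self_left[OF assms(2)] assms(3) by (metis matrix_mul_assoc)
  ultimately show ?thesis
    using symmetric_preserves_cone_iff_indef_dual[OF assms(2)] is_cone_convex_cone[OF assms(4)]
      assms(5)
    by simp
qed

end
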